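(* Let $k\ge0$, and let $$F^{(k)}(t,u,v,x)=\sum_{c,i,j,n\ge0}|\{\pi\in\mathcal{A}^{(k)}_n : \operatorname{cyc}(\pi)=c,\ \operatorname{fp}(\pi)=i,\ \operatorname{exc}(\pi)=j\}|\; t^c u^i v^j x^n.$$ Then $F^{(k)}(t,u,v,x)$ equals the finite continued fraction $$\cfrac{1}{1-tux-\cfrac{tvx^2}{1-((1+v)+tu)x-\cfrac{2(1+t)vx^2}{1-(2(1+v)+tu)x-\cfrac{3(2+t)vx^2}{\ddots\; 1-((k-1)(1+v)+tu)x-\cfrac{k(k-1+t)vx^2}{1-(k(1+v)+tu)x}}}}}.$$ That is, $F^{(k)}=1/C_0$, where $C_k=1-(k(1+v)+tu)x$ and $C_h=1-(h(1+v)+tu)x-\dfrac{(h+1)(h+t)vx^2}{C_{h+1}}$ for $0\le h<k$.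
   Context: $\mathcal{S}_n$ is the set of permutations of $\{1,\dots,n\}$. For $k\ge0$, $$\mathcal{A}^{(k)}_n=\{\pi\in\mathcal{S}_n : |\{j : j\le i\text{ and }\pi(j)>i\}|\le k\text{ for every } i\in\{1,\dots,n\}\},$$ where for $n=0$ the set consists of the empty permutation only, contributing $1$ to the generating function. For $\pi\in\mathcal{S}_n$, $\operatorname{cyc}(\pi)$ is the number of cycles of $\pi$ (fixed points included as cycles of length 1), $\operatorname{fp}(\pi)$ is the number of $i$ with $\pi(i)=i$, and $\operatorname{exc}(\pi)$ is the number of $i$ with $\pi(i)>i$. The identity is one of formal power series in $x$ with coefficients polynomials in $t,u,v$. *)

theory Defs
  imports
    "HOL-Combinatorics.Permutations"
    "HOL-Combinatorics.Orbits"
    "HOL-Computational_Algebra.Formal_Power_Series"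
    "HOL-Computational_Algebra.Polynomial"
begin

definition bounded_perms :: "nat \<Rightarrow> nat \<Rightarrow> (nat \<Rightarrow> nat) set" where
  "bounded_perms k n =
     {p. p permutes {1..n} \<and> (\<forall>i\<in>{1..n}. card {j\<in>{1..n}. j \<le> i \<and> p j > i} \<le> k)}"

text \<open>A cycle is identified with its orbit, so fixed points count as cycles of length one.\<close>

definition cyc :: "nat \<Rightarrow> (nat \<Rightarrow> nat) \<Rightarrow> nat" where
  "cyc n p = card (orbit p ` {1..n})"

definition fp :: "nat \<Rightarrow> (nat \<Rightarrow> nat) \<Rightarrow> nat" where
  "fp n p = card {i\<in>{1..n}. p i = i}"

definition exc :: "nat \<Rightarrow> (nat \<Rightarrow> nat) \<Rightarrow> nat" where
  "exc n p = card {i\<in>{1..n}. p i > i}"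

lemma cyc_le: "cyc n p \<le> n"
  using card_image_le[of "{1..n}" "orbit p"] by (simp add: cyc_def)

lemma fp_le: "fp n p \<le> n"
  using card_mono[OF finite_atLeastAtMost Collect_restrict, of 1 n "\<lambda>i. p i = i"] by (simp add: fp_def)

lemma exc_le: "exc n p \<le> n"
  using card_mono[OF finite_atLeastAtMost Collect_restrict, of 1 n "\<lambda>i. p i > i"] by (simp add: exc_def)

text \<open>
  The coefficient ring \<open>\<int>[t,u,v]\<close> is rendered as iterated univariate polynomials, i.e.
  as \<open>\<int>[t][u][v]\<close>; \<open>x\<close> is the power series variable.
\<close>

type_synonym coeff_ring = "int poly poly poly"

definition var_t :: coeff_ring where "var_t = [:[:[:0, 1:]:]:]"
definition var_u :: coeff_ring where "var_u = [:[:0, 1:]:]"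
definition var_v :: coeff_ring where "var_v = [:0, 1:]"

text \<open>
  For fixed \<open>n\<close> each of the three statistics is at most \<open>n\<close> (lemmas \<open>cyc_le\<close>, \<open>fp_le\<close>,
  \<open>exc_le\<close>), so truncating the sum over \<open>c\<close>, \<open>i\<close>, \<open>j\<close> at \<open>n\<close> drops only zero terms.
\<close>

definition F :: "nat \<Rightarrow> coeff_ring fps" where
  "F k = Abs_fps (\<lambda>n. \<Sum>c\<le>n. \<Sum>i\<le>n. \<Sum>j\<le>n.
     of_nat (card {p \<in> bounded_perms k n. cyc n p = c \<and> fp n p = i \<and> exc n p = j})
       * (var_t ^ c * var_u ^ i * var_v ^ j))"

text \<open>
  Reciprocal of a power series with constant term \<open>1\<close> over an arbitrary ring.  The operation
  \<open>inverse\<close> on power series is not available here, because it needs inverses in the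
  coefficient ring.
\<close>

definition fps_recip :: "'a::comm_ring_1 fps \<Rightarrow> 'a fps" where
  "fps_recip f = fps_right_inverse f 1"

lemma fps_recip: "fps_nth f 0 = 1 \<Longrightarrow> f * fps_recip f = 1"
  unfolding fps_recip_def by (rule fps_right_inverse) simp

definition lin_level :: "nat \<Rightarrow> coeff_ring fps" where
  "lin_level h = 1 - fps_const (of_nat h * (1 + var_v) + var_t * var_u) * fps_X"

text \<open>The denominator \<open>C\<^sub>h\<close> of the continued fraction of depth \<open>k\<close>; only \<open>h \<le> k\<close> is relevant.\<close>

function cf_denom :: "nat \<Rightarrow> nat \<Rightarrow> coeff_ring fps" where
  "cf_denom k h =
     (if h < k
      then lin_level h
             - fps_const (of_nat (h + 1) * (of_nat h + var_t) * var_v) * fps_X ^ 2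
               * fps_recip (cf_denom k (h + 1))
      else lin_level h)"
  by pat_completeness auto
termination by (relation "measure (\<lambda>(k, h). k - h)") auto

declare cf_denom.simps [simp del]

text \<open>Every denominator has constant term \<open>1\<close>, so all reciprocals above are genuine.\<close>

lemma cf_denom_nth_0: "fps_nth (cf_denom k h) 0 = 1"
  by (subst cf_denom.simps) (simp add: lin_level_def)

lemma cf_denom_recip: "cf_denom k h * fps_recip (cf_denom k h) = 1"
  by (intro fps_recip cf_denom_nth_0)

end

theory Submission
  imports Defs
begin

text \<open>
  Restrict a permutation of \<open>{1..n}\<close> to the arrows inside \<open>{1..m}\<close>: this leaves some closed cycles
  and \<open>h\<close> open chains, where \<open>h\<close> is the number of \<open>j \<le> m\<close> with image above \<open>m\<close>.  When \<open>m + 1\<close> is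
  added, it becomes a new chain (weight \<open>v\<close>), a fixed point (\<open>t u\<close>), the new end or the new start
  of one of the chains (\<open>h v\<close> and \<open>h\<close>), or it joins a chain end to a chain start
  (\<open>h (h - 1 + t)\<close>, since \<open>h\<close> of the \<open>h\<^sup>2\<close> joins close a cycle).  Hence the generating
  functions \<open>G\<^sub>h\<close> of the partial permutations with \<open>h\<close> open chains satisfy a three-term recurrence
  in \<open>h\<close>, cut off above \<open>k\<close>, and descending induction on \<open>h\<close> turns it into
  \<open>C\<^sub>h G\<^sub>h = v x G\<^bsub>h-1\<^esub>\<close> for \<open>h > 0\<close> and \<open>C\<^sub>0 G\<^sub>0 = 1\<close>, where \<open>G\<^sub>0 = F\<close>.
\<close>

section \<open>Partial permutations\<close>

text \<open>
  The value \<open>0\<close> marks the positions whose image is still undetermined; as in \<open>permutes\<close>, a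
  function is the identity outside \<open>{1..n}\<close>.
\<close>

definition partial_perms :: "nat \<Rightarrow> (nat \<Rightarrow> nat) set" where
  "partial_perms n = {f. (\<forall>j. j \<notin> {1..n} \<longrightarrow> f j = j) \<and> (\<forall>j\<in>{1..n}. f j \<le> n) \<and>
     inj_on f {j\<in>{1..n}. f j \<noteq> 0}}"

definition ends :: "nat \<Rightarrow> (nat \<Rightarrow> nat) \<Rightarrow> nat set" where
  "ends n f = {j\<in>{1..n}. f j = 0}"

definition starts :: "nat \<Rightarrow> (nat \<Rightarrow> nat) \<Rightarrow> nat set" where
  "starts n f = {1..n} - f ` {1..n}"

text \<open>
  A choice \<open>(a, b)\<close> lets \<open>a\<close> be mapped to \<open>n + 1\<close> and \<open>n + 1\<close> to \<open>b\<close>.  Here \<open>a = n + 1\<close> together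
  with \<open>b \<noteq> n + 1\<close> means that \<open>n + 1\<close> gets no preimage: in \<open>extend\<close> the second update
  overrides the first.
\<close>

definition choices :: "nat \<Rightarrow> (nat \<Rightarrow> nat) \<Rightarrow> (nat \<times> nat) set" where
  "choices n f = insert (Suc n, Suc n) (insert (Suc n) (ends n f) \<times> insert 0 (starts n f))"

definition extend :: "nat \<Rightarrow> (nat \<Rightarrow> nat) \<Rightarrow> nat \<times> nat \<Rightarrow> nat \<Rightarrow> nat" where
  "extend n f = (\<lambda>(a, b). f(a := Suc n, Suc n := b))"

definition truncate :: "nat \<Rightarrow> (nat \<Rightarrow> nat) \<Rightarrow> nat \<Rightarrow> nat" where
  "truncate n f j = (if j = Suc n then Suc n else if f j = Suc n then 0 else f j)"

lemma partial_perms_outside: "f \<in> partial_perms n \<Longrightarrow> j \<notin> {1..n} \<Longrightarrow> f j = j"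
  by (auto simp: partial_perms_def)

lemma partial_perms_0: "f \<in> partial_perms n \<Longrightarrow> f 0 = 0"
  by (auto simp: partial_perms_def)

lemma partial_perms_le: "f \<in> partial_perms n \<Longrightarrow> j \<le> n \<Longrightarrow> f j \<le> n"
  by (cases "j = 0") (auto simp: partial_perms_def)

lemma partial_perms_inj:
  "f \<in> partial_perms n \<Longrightarrow> f i = f j \<Longrightarrow> f j \<noteq> 0 \<Longrightarrow> i \<in> {1..n} \<Longrightarrow> j \<in> {1..n} \<Longrightarrow> i = j"
  unfolding partial_perms_def inj_on_def by auto

lemma finite_ends [simp]: "finite (ends n f)"
  and finite_starts [simp]: "finite (starts n f)"
  by (auto simp: ends_def starts_def)

lemma card_starts:
  assumes "f \<in> partial_perms n"
  shows "card (starts n f) = card (ends n f)"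
proof -
  let ?D = "{j\<in>{1..n}. f j \<noteq> 0}"
  have "starts n f = {1..n} - f ` ?D"
    by (auto simp: starts_def image_iff)
  moreover have "f ` ?D \<subseteq> {1..n}"
    using partial_perms_le[OF assms] by (simp add: image_subset_iff Suc_le_eq)
  ultimately have "card (starts n f) = n - card (f ` ?D)"
    by (simp add: card_Diff_subset)
  also have "card (f ` ?D) = card ?D"
    using assms by (intro card_image) (auto simp: partial_perms_def)
  also have "n - card ?D = card ({1..n} - ?D)"
    by (subst card_Diff_subset) auto
  also have "{1..n} - ?D = ends n f"
    by (auto simp: ends_def)
  finally show ?thesis .
qed

lemma extend_in_partial_perms:
  assumes g: "g \<in> partial_perms n" and c: "(a, b) \<in> choices n g"
  shows "extend n g (a, b) \<in> partial_perms (Suc n)"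
proof -
  have "inj_on (g(a := Suc n, Suc n := b)) {j\<in>{1..Suc n}. (g(a := Suc n, Suc n := b)) j \<noteq> 0}"
  proof (rule inj_onI)
    fix i j
    assume "i \<in> {j\<in>{1..Suc n}. (g(a := Suc n, Suc n := b)) j \<noteq> 0}"
      "j \<in> {j\<in>{1..Suc n}. (g(a := Suc n, Suc n := b)) j \<noteq> 0}"
      "(g(a := Suc n, Suc n := b)) i = (g(a := Suc n, Suc n := b)) j"
    then show "i = j"
      using c partial_perms_le[OF g, of i] partial_perms_le[OF g, of j] partial_perms_inj[OF g, of i j]
      by (auto simp: choices_def ends_def starts_def le_Suc_eq split: if_splits)
  qed
  then show ?thesis
    using c g by (auto simp: extend_def partial_perms_def choices_def ends_def starts_def le_Suc_eq)
qed

lemma truncate_extend: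
  assumes g: "g \<in> partial_perms n" and c: "(a, b) \<in> choices n g"
  shows "truncate n (extend n g (a, b)) = g"
proof
  fix j
  have "g j \<noteq> Suc n" if "j \<noteq> Suc n"
    using that partial_perms_le[OF g, of j] partial_perms_outside[OF g, of j] by (cases "j \<le> n") auto
  then show "truncate n (extend n g (a, b)) j = g j"
    using c partial_perms_outside[OF g, of "Suc n"]
    by (auto simp: truncate_def extend_def choices_def ends_def)
qed

lemma truncate_in_partial_perms:
  assumes f: "f \<in> partial_perms (Suc n)"
  shows "truncate n f \<in> partial_perms n"
proof -
  have "inj_on (truncate n f) {j\<in>{1..n}. truncate n f j \<noteq> 0}"
    by (rule inj_onI, rule partial_perms_inj[OF f]) (auto simp: truncate_def split: if_splits)
  then show ?thesis
    using f unfolding partial_perms_def by (auto simp: truncate_def le_Suc_eq)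
qed

lemma ex_extend_truncate:
  assumes f: "f \<in> partial_perms (Suc n)"
  shows "\<exists>c\<in>choices n (truncate n f). f = extend n (truncate n f) c"
proof -
  have ne: "f (Suc n) \<noteq> f j" if "f (Suc n) \<noteq> 0" "j \<in> {1..n}" for j
    using that partial_perms_inj[OF f, of j "Suc n"] by fastforce
  have *: "f (Suc n) \<in> insert (Suc n) (insert 0 (starts n (truncate n f)))"
  proof (cases "f (Suc n) = 0 \<or> f (Suc n) = Suc n")
    case False
    then have "f (Suc n) \<in> {1..n}"
      using partial_perms_le[OF f, of "Suc n"] by auto
    moreover have "f (Suc n) \<notin> truncate n f ` {1..n}"
      using False ne unfolding image_iff truncate_def by (metis (no_types, lifting))
    ultimately show ?thesis by (simp add: starts_def)
  qed auto
  show ?thesis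
  proof (cases "\<exists>a\<in>{1..n}. f a = Suc n")
    case True
    then obtain a where a: "a \<in> {1..n}" "f a = Suc n" by auto
    have "f j \<noteq> Suc n" if "j \<noteq> a" for j
      using that partial_perms_inj[OF f, of j a] a partial_perms_outside[OF f, of j]
      by (cases "j \<in> {1..Suc n}") auto
    then have eq: "f = extend n (truncate n f) (a, f (Suc n))"
      using a by (auto simp: extend_def truncate_def)
    have "f (Suc n) \<noteq> Suc n"
      using partial_perms_inj[OF f, of a "Suc n"] a by auto
    then have "(a, f (Suc n)) \<in> choices n (truncate n f)"
      using a * by (auto simp: choices_def ends_def truncate_def)
    with eq show ?thesis by (rule bexI)
  next
    case False
    then have "f j \<noteq> Suc n" if "j \<noteq> Suc n" for j
      using that partial_perms_outside[OF f, of j] by (cases "j \<in> {1..n}") auto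
    then have "f = extend n (truncate n f) (Suc n, f (Suc n))"
      by (intro ext) (simp add: extend_def truncate_def)
    moreover have "(Suc n, f (Suc n)) \<in> choices n (truncate n f)"
      using * by (auto simp: choices_def)
    ultimately show ?thesis by (rule bexI)
  qed
qed

lemma extend_inj:
  assumes g: "g \<in> partial_perms n" and c: "c \<in> choices n g" "c' \<in> choices n g"
    and eq: "extend n g c = extend n g c'"
  shows "c = c'"
proof -
  obtain a b a' b' where ab: "c = (a, b)" "c' = (a', b')" by (metis surj_pair)
  have "b = b'"
    using fun_cong[OF eq, of "Suc n"] by (simp add: ab extend_def)
  moreover have "a = a'"
  proof (rule ccontr)
    assume "a \<noteq> a'"
    then show False
      using fun_cong[OF eq, of a] fun_cong[OF eq, of a'] c
      by (auto simp: ab extend_def choices_def ends_def starts_def split: if_splits)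
  qed
  ultimately show ?thesis by (simp add: ab)
qed

lemma bij_betw_extend:
  "bij_betw (\<lambda>(g, c). extend n g c) (SIGMA g:partial_perms n. choices n g) (partial_perms (Suc n))"
  unfolding bij_betw_def
proof
  show "inj_on (\<lambda>(g, c). extend n g c) (SIGMA g:partial_perms n. choices n g)"
  proof (rule inj_onI)
    fix x y
    assume x: "x \<in> (SIGMA g:partial_perms n. choices n g)" and y: "y \<in> (SIGMA g:partial_perms n. choices n g)"
      and eq: "(\<lambda>(g, c). extend n g c) x = (\<lambda>(g, c). extend n g c) y"
    obtain g c h d where xy: "x = (g, c)" "y = (h, d)" by (metis surj_pair)
    have "g = truncate n (extend n g c)" "h = truncate n (extend n h d)"
      using x y truncate_extend[of g n "fst c" "snd c"] truncate_extend[of h n "fst d" "snd d"]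
      by (simp_all add: xy)
    then have "g = h" using eq by (simp add: xy)
    with x y eq show "x = y"
      using extend_inj[of g n c d] by (simp add: xy)
  qed
  show "(\<lambda>(g, c). extend n g c) ` (SIGMA g:partial_perms n. choices n g) = partial_perms (Suc n)"
  proof (intro equalityI subsetI)
    fix f assume f: "f \<in> partial_perms (Suc n)"
    then obtain c where "c \<in> choices n (truncate n f)" "f = extend n (truncate n f) c"
      using ex_extend_truncate by blast
    then show "f \<in> (\<lambda>(g, c). extend n g c) ` (SIGMA g:partial_perms n. choices n g)"
      using truncate_in_partial_perms[OF f] by (intro image_eqI[of _ _ "(truncate n f, c)"]) auto
  qed (auto simp: extend_in_partial_perms)
qed

lemma partial_perms_zero: "partial_perms 0 = {id}"
  by (auto simp: partial_perms_def)

lemma finite_partial_perms: "finite (partial_perms n)"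
proof (induction n)
  case (Suc n)
  then have "finite (SIGMA g:partial_perms n. choices n g)"
    by (auto simp: choices_def)
  then show ?case
    using bij_betw_finite[OF bij_betw_extend] by blast
qed (simp add: partial_perms_zero)

lemma chain_end:
  assumes g: "g \<in> partial_perms n" and b: "b \<in> starts n g"
  obtains m where "(g ^^ Suc m) b = 0" "\<And>l. l \<le> m \<Longrightarrow> (g ^^ l) b \<in> {1..n}"
proof -
  have le: "(g ^^ l) b \<le> n" for l
    using b partial_perms_le[OF g] by (induction l) (auto simp: starts_def)
  have "\<exists>l. (g ^^ l) b = 0"
  proof (rule ccontr)
    assume "\<nexists>l. (g ^^ l) b = 0"
    then have pos: "(g ^^ l) b \<in> {1..n}" for l
      using le[of l] by (cases "(g ^^ l) b") (metis, auto)
    have diff: "i = j" if "(g ^^ i) b = (g ^^ j) b" for i j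
      using that
    proof (induction i arbitrary: j)
      case 0
      then show ?case
        using b pos by (cases j) (auto simp: starts_def)
    next
      case (Suc i)
      show ?case
      proof (cases j)
        case 0
        with Suc.prems have "b = g ((g ^^ i) b)" by simp
        then show ?thesis using b pos[of i] unfolding starts_def by blast
      next
        case (Suc j')
        then have "(g ^^ i) b = (g ^^ j') b"
          using Suc.prems pos[of i] pos[of j'] pos[of "Suc j'"] partial_perms_inj[OF g] by simp
        then show ?thesis using Suc.IH Suc by simp
      qed
    qed
    then have "inj (\<lambda>l. (g ^^ l) b)" by (rule injI)
    moreover have "range (\<lambda>l. (g ^^ l) b) \<subseteq> {1..n}" using pos by auto
    ultimately show False
      using finite_subset[OF _ finite_atLeastAtMost] finite_imageD infinite_UNIV_nat by blast
  qed
  define m where "m = (LEAST l. (g ^^ l) b = 0)"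
  have m: "(g ^^ m) b = 0" and least: "\<And>l. l < m \<Longrightarrow> (g ^^ l) b \<noteq> 0"
    unfolding m_def using \<open>\<exists>l. (g ^^ l) b = 0\<close> by (auto intro: LeastI_ex dest: not_less_Least)
  have "m \<noteq> 0"
    using m b by (auto simp: starts_def intro!: Nat.gr0I)
  then obtain m' where "m = Suc m'" by (cases m) auto
  then show ?thesis
    using that[of m'] m least le by (force simp: Suc_le_eq less_Suc_eq_le)
qed

text \<open>
  This is the source of the factor \<open>h - 1 + t\<close>: for each of the \<open>h\<close> chain starts, exactly one
  of the \<open>h\<close> chain ends closes a cycle.
\<close>

lemma ex_chain_end_closes:
  assumes g: "g \<in> partial_perms n" and b: "b \<in> starts n g"
  shows "\<exists>e\<in>ends n g. \<forall>a\<in>ends n g. Suc n \<in> orbit (extend n g (a, b)) (Suc n) \<longleftrightarrow> a = e"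
proof -
  obtain m where m: "(g ^^ Suc m) b = 0" "\<And>l. l \<le> m \<Longrightarrow> (g ^^ l) b \<in> {1..n}"
    using chain_end[OF g b] by blast
  define e where "e = (g ^^ m) b"
  have e: "e \<in> ends n g"
    using m by (auto simp: ends_def e_def)
  have inner: "(g ^^ l) b \<notin> ends n g" if "l < m" for l
    using m(2)[of "Suc l"] that by (auto simp: ends_def)
  have path: "(extend n g (a, b) ^^ Suc l) (Suc n) = (g ^^ l) b" if a: "a \<in> ends n g" and "l \<le> m" for a l
    using that(2)
  proof (induction l)
    case 0
    then show ?case by (simp add: extend_def)
  next
    case (Suc l)
    then have "(g ^^ l) b \<noteq> a" "(g ^^ l) b \<noteq> Suc n"
      using a inner[of l] m(2)[of l] by auto
    then show ?case
      using Suc by (simp add: extend_def)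
  qed
  have "Suc n \<in> orbit (extend n g (a, b)) (Suc n) \<longleftrightarrow> a = e" if a: "a \<in> ends n g" for a
  proof
    assume "a = e"
    then have "(extend n g (a, b) ^^ Suc (Suc m)) (Suc n) = Suc n"
      using path[OF a, of m] m(2)[of m] by (simp add: e_def extend_def)
    then show "Suc n \<in> orbit (extend n g (a, b)) (Suc n)"
      unfolding orbit_altdef by (metis (mono_tags, lifting) mem_Collect_eq zero_less_Suc)
  next
    assume "Suc n \<in> orbit (extend n g (a, b)) (Suc n)"
    show "a = e"
    proof (rule ccontr)
      assume ae: "a \<noteq> e"
      have *: "extend n g (a, b) e = 0" "extend n g (a, b) 0 = 0"
        using e ae a partial_perms_0[OF g] by (auto simp: extend_def ends_def)
      have "(extend n g (a, b) ^^ Suc (Suc m + l)) (Suc n) = 0" for l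
        using path[OF a, of m] * by (induction l) (simp_all add: e_def)
      then have "(extend n g (a, b) ^^ Suc l) (Suc n) \<noteq> Suc n" for l
        using path[OF a, of l] m(2)[of l] le_Suc_ex[of "Suc m" l] by (cases "l \<le> m") (fastforce, metis not_less_eq_eq Zero_not_Suc)
      then show False
        using \<open>Suc n \<in> orbit (extend n g (a, b)) (Suc n)\<close> unfolding orbit_altdef
        by (auto simp: gr0_conv_Suc) metis
    qed
  qed
  with e show ?thesis by blast
qed

section \<open>Weights and the three-term recurrence\<close>

text \<open>
  Attributing each cycle to its maximum makes the number of cycles a sum of local
  contributions that are already visible in the truncation to \<open>{1..m}\<close>.
\<close>

definition cycle_max :: "nat \<Rightarrow> (nat \<Rightarrow> nat) \<Rightarrow> bool" where
  "cycle_max m f \<longleftrightarrow> m \<in> orbit f m \<and> orbit f m \<subseteq> {..m}"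

definition level :: "nat \<Rightarrow> (nat \<Rightarrow> nat) \<Rightarrow> nat" where
  "level m f = card {j\<in>{1..m}. f j = 0 \<or> f j > m}"

definition local_weight :: "nat \<Rightarrow> nat \<Rightarrow> (nat \<Rightarrow> nat) \<Rightarrow> coeff_ring" where
  "local_weight k m f =
     (if cycle_max m f then var_t else 1) * (if f m = m then var_u else 1) *
     (if f m = 0 \<or> f m > m then var_v else 1) * (if level m f \<le> k then 1 else 0)"

definition weight :: "nat \<Rightarrow> nat \<Rightarrow> (nat \<Rightarrow> nat) \<Rightarrow> coeff_ring" where
  "weight k n f = (\<Prod>m=1..n. local_weight k m f)"

lemma orbit_subset_closed:
  assumes "x \<in> A" "\<And>y. y \<in> A \<Longrightarrow> f y \<in> A"
  shows "orbit f x \<subseteq> A"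
proof
  fix y assume "y \<in> orbit f x"
  then show "y \<in> A" by induction (use assms in auto)
qed

lemma orbit_eq_on_atMost:
  assumes "f 0 = 0" "0 < m" "cycle_max m f"
    and "\<And>j. j \<in> {1..m} \<Longrightarrow> f j \<in> {1..m} \<Longrightarrow> g j = f j"
  shows "orbit g m = orbit f m"
proof (rule orbit_cong)
  show "m \<in> orbit f m" using assms by (simp add: cycle_max_def)
  have zero: "0 \<notin> orbit f m"
  proof
    assume "0 \<in> orbit f m"
    then have "m \<in> orbit f 0"
      using assms(3) orbit_swap[of m f 0] by (simp add: cycle_max_def)
    also have "orbit f 0 = {0}"
      using assms(1) by (simp add: orbit_eq_singleton_iff)
    finally show False using assms(2) by simp
  qed
  have pos: "s \<in> {1..m}" if "s \<in> orbit f m" for s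
  proof -
    have "s \<noteq> 0" using that zero by metis
    then show ?thesis using that assms(3) by (auto simp: cycle_max_def Suc_le_eq)
  qed
  then show "g s = f s" if "s \<in> orbit f m" for s
    using that by (intro assms(4)) (auto intro: orbit.step)
qed

lemma local_weight_truncate:
  assumes f: "f \<in> partial_perms (Suc n)" and m: "m \<in> {1..n}"
  shows "local_weight k m (truncate n f) = local_weight k m f"
proof -
  let ?g = "truncate n f"
  have g: "?g \<in> partial_perms n" using truncate_in_partial_perms[OF f] .
  have g_eq: "?g j = f j" if "j \<in> {1..m}" "f j \<noteq> Suc n" for j
    using that m by (auto simp: truncate_def)
  have "orbit ?g m = orbit f m" if "cycle_max m f"
    using partial_perms_0[OF f] that m by (intro orbit_eq_on_atMost g_eq) auto
  moreover have "orbit f m = orbit ?g m" if "cycle_max m ?g"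
    using partial_perms_0[OF g] that m
    by (intro orbit_eq_on_atMost) (auto simp: truncate_def split: if_splits)
  ultimately have "cycle_max m ?g \<longleftrightarrow> cycle_max m f"
    by (metis cycle_max_def)
  moreover have "?g m = m \<longleftrightarrow> f m = m" "?g m = 0 \<or> ?g m > m \<longleftrightarrow> f m = 0 \<or> f m > m"
    using m by (auto simp: truncate_def)
  moreover have "{j\<in>{1..m}. ?g j = 0 \<or> ?g j > m} = {j\<in>{1..m}. f j = 0 \<or> f j > m}"
    using m by (auto simp: truncate_def split: if_splits)
  ultimately show ?thesis
    by (simp add: local_weight_def level_def)
qed

lemma weight_Suc:
  assumes "f \<in> partial_perms (Suc n)"
  shows "weight k (Suc n) f = weight k n (truncate n f) * local_weight k (Suc n) f"
  using assms by (simp add: weight_def local_weight_truncate mult.commute)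

lemma level_eq_card_ends:
  assumes "f \<in> partial_perms n"
  shows "level n f = card (ends n f)"
proof -
  have "\<not> f j > n" if "j \<in> {1..n}" for j
    using partial_perms_le[OF assms, of j] that by auto
  then have "{j\<in>{1..n}. f j = 0 \<or> f j > n} = ends n f"
    by (auto simp: ends_def)
  then show ?thesis by (simp add: level_def)
qed

lemma cycle_max_Suc_iff:
  assumes "f \<in> partial_perms (Suc n)"
  shows "cycle_max (Suc n) f \<longleftrightarrow> Suc n \<in> orbit f (Suc n)"
  using partial_perms_le[OF assms] orbit_subset_closed[of "Suc n" "{..Suc n}" f]
  by (auto simp: cycle_max_def)

lemma not_in_orbit_no_preimage:
  "(\<And>y. f y \<noteq> x) \<Longrightarrow> x \<notin> orbit f z"
  by (metis orbit.cases)

lemma ends_extend: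
  assumes g: "g \<in> partial_perms n" and c: "(a, b) \<in> choices n g"
  shows "ends (Suc n) (extend n g (a, b)) = (if b = 0 then insert (Suc n) else id) (ends n g - {a})"
  using c by (auto simp: ends_def extend_def choices_def starts_def le_Suc_eq)

definition closes :: "nat \<Rightarrow> (nat \<Rightarrow> nat) \<Rightarrow> nat \<Rightarrow> nat \<Rightarrow> bool" where
  "closes n g a b \<longleftrightarrow> Suc n \<in> orbit (extend n g (a, b)) (Suc n)"

lemma local_weight_extend:
  assumes g: "g \<in> partial_perms n" and c: "(a, b) \<in> choices n g"
  shows "local_weight k (Suc n) (extend n g (a, b)) * \<phi> (card (ends (Suc n) (extend n g (a, b)))) =
    (if closes n g a b then var_t else 1) * (if b = Suc n then var_u else 1) * (if b = 0 then var_v else 1) *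
    (let h' = card (ends (Suc n) (extend n g (a, b))) in if h' \<le> k then \<phi> h' else 0)"
proof -
  have f: "extend n g (a, b) \<in> partial_perms (Suc n)"
    using extend_in_partial_perms[OF g c] .
  have "extend n g (a, b) (Suc n) = b" by (simp add: extend_def)
  moreover have "\<not> b > Suc n" using c by (auto simp: choices_def starts_def)
  ultimately show ?thesis
    by (simp add: local_weight_def closes_def cycle_max_Suc_iff[OF f] level_eq_card_ends[OF f] Let_def)
qed

lemma sum_choices:
  fixes k :: nat and \<phi> :: "nat \<Rightarrow> coeff_ring"
  assumes g: "g \<in> partial_perms n"
  defines "h \<equiv> card (ends n g)"
    and "\<psi> \<equiv> \<lambda>h. if h \<le> k then \<phi> h else 0"
  shows "(\<Sum>c\<in>choices n g. local_weight k (Suc n) (extend n g c) * \<phi> (card (ends (Suc n) (extend n g c)))) =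
    var_v * \<psi> (Suc h) + (of_nat h * (1 + var_v) + var_t * var_u) * \<psi> h +
    of_nat h * (of_nat (h - 1) + var_t) * \<psi> (h - 1)"
proof -
  define T where "T = (\<lambda>c. local_weight k (Suc n) (extend n g c) *
    \<phi> (card (ends (Suc n) (extend n g c))))"
  let ?E = "ends n g" and ?B = "starts n g"
  have notin: "Suc n \<notin> ?E" "Suc n \<notin> ?B" "0 \<notin> ?B"
    by (auto simp: ends_def starts_def)
  have card_B: "card ?B = h"
    using card_starts[OF g] by (simp add: h_def)
  have T: "T (a, b) = (if closes n g a b then var_t else 1) * (if b = Suc n then var_u else 1) *
      (if b = 0 then var_v else 1) *
      \<psi> (card ((if b = 0 then insert (Suc n) else id) (ends n g - {a})))"
    if "(a, b) \<in> choices n g" for a b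
    using local_weight_extend[OF g that, of k \<phi>] ends_extend[OF g that]
    by (simp add: T_def \<psi>_def Let_def)
  have g_ne: "g j \<noteq> Suc n" if "j \<noteq> Suc n" for j
    using that partial_perms_le[OF g, of j] partial_perms_outside[OF g, of j] by (cases "j \<le> n") auto
  have "extend n g (Suc n, Suc n) (Suc n) = Suc n" by (simp add: extend_def)
  then have "closes n g (Suc n) (Suc n)"
    unfolding closes_def by (metis orbit.base)
  then have fixed: "T (Suc n, Suc n) = var_t * var_u * \<psi> h"
    using notin by (subst T) (auto simp: choices_def h_def)
  have not_closes: "\<not> closes n g (Suc n) b" if "b \<noteq> Suc n" for b
    unfolding closes_def by (rule not_in_orbit_no_preimage) (use that g_ne in \<open>auto simp: extend_def\<close>)
  have not_closes': "\<not> closes n g a 0" if "a \<in> ?E" for a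
  proof -
    have "orbit (extend n g (a, 0)) (Suc n) \<subseteq> {0}"
    proof
      fix y assume "y \<in> orbit (extend n g (a, 0)) (Suc n)"
      then show "y \<in> {0}"
        by induction (use that partial_perms_0[OF g] in \<open>auto simp: extend_def ends_def\<close>)
    qed
    then show ?thesis by (auto simp: closes_def)
  qed
  have up: "T (Suc n, 0) = var_v * \<psi> (Suc h)"
    using notin not_closes[of 0] by (subst T) (auto simp: choices_def h_def)
  have end_only: "T (Suc n, b) = \<psi> h" if "b \<in> ?B" for b
  proof -
    have "b \<noteq> 0" "b \<noteq> Suc n" using that notin by metis+
    then show ?thesis
      using that notin(1) not_closes[of b] by (subst T) (auto simp: choices_def h_def)
  qed
  have start_only: "T (a, 0) = var_v * \<psi> h" if "a \<in> ?E" for a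
  proof -
    have "h > 0" using that by (auto simp: h_def card_gt_0_iff)
    then show ?thesis
      using that notin not_closes'[of a] by (subst T) (auto simp: choices_def h_def card_Diff_singleton)
  qed
  have join: "(\<Sum>a\<in>?E. T (a, b)) = (of_nat (h - 1) + var_t) * \<psi> (h - 1)" if b: "b \<in> ?B" for b
  proof -
    obtain e where e: "e \<in> ?E" "\<And>a. a \<in> ?E \<Longrightarrow> closes n g a b \<longleftrightarrow> a = e"
      using ex_chain_end_closes[OF g b] unfolding closes_def by blast
    have "b \<noteq> 0" "b \<noteq> Suc n" using b notin by metis+
    then have "T (a, b) = (if a = e then var_t else 1) * \<psi> (h - 1)" if "a \<in> ?E" for a
      using that b e(2)[of a] by (subst T) (auto simp: choices_def h_def card_Diff_singleton)
    then have "(\<Sum>a\<in>?E. T (a, b)) = (\<Sum>a\<in>?E. (if a = e then var_t else 1)) * \<psi> (h - 1)"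
      by (simp add: sum_distrib_right)
    also have "(\<Sum>a\<in>?E. (if a = e then var_t else 1)) = var_t + (\<Sum>a\<in>?E - {e}. 1)"
      using e(1) by (subst sum.remove[of _ e]) auto
    also have "(\<Sum>a\<in>?E - {e}. 1) = (of_nat (h - 1) :: coeff_ring)"
      using e(1) by (simp add: h_def card_Diff_singleton)
    finally show ?thesis by (simp add: add.commute)
  qed
  have "(\<Sum>c\<in>choices n g. T c) = T (Suc n, Suc n) + (\<Sum>c\<in>insert (Suc n) ?E \<times> insert 0 ?B. T c)"
    unfolding choices_def using notin by (subst sum.insert) auto
  also have "(\<Sum>c\<in>insert (Suc n) ?E \<times> insert 0 ?B. T c) =
      (\<Sum>a\<in>insert (Suc n) ?E. \<Sum>b\<in>insert 0 ?B. T (a, b))"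
    by (simp add: sum.cartesian_product)
  also have "\<dots> = T (Suc n, 0) + (\<Sum>b\<in>?B. T (Suc n, b)) + ((\<Sum>a\<in>?E. T (a, 0)) + (\<Sum>a\<in>?E. \<Sum>b\<in>?B. T (a, b)))"
    using notin by (simp add: sum.distrib)
  also have "(\<Sum>a\<in>?E. \<Sum>b\<in>?B. T (a, b)) = (\<Sum>b\<in>?B. \<Sum>a\<in>?E. T (a, b))"
    by (rule sum.swap)
  finally have "(\<Sum>c\<in>choices n g. T c) = var_t * var_u * \<psi> h + (var_v * \<psi> (Suc h) + of_nat h * \<psi> h +
      (of_nat h * (var_v * \<psi> h) + of_nat h * ((of_nat (h - 1) + var_t) * \<psi> (h - 1))))"
    using card_B by (simp add: fixed up end_only start_only join h_def[symmetric])
  then show ?thesis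
    by (simp only: T_def) (simp only: ring_distribs mult_ac add_ac mult_1_left mult_1_right)
qed

definition partial_sum :: "nat \<Rightarrow> nat \<Rightarrow> nat \<Rightarrow> coeff_ring" where
  "partial_sum k n h = (\<Sum>f\<in>{f\<in>partial_perms n. card (ends n f) = h}. weight k n f)"

lemma partial_sum_altdef:
  "partial_sum k n h = (\<Sum>f\<in>partial_perms n. weight k n f * of_bool (card (ends n f) = h))"
  unfolding partial_sum_def using finite_partial_perms
  by (intro sum.mono_neutral_cong_left) auto

lemma partial_sum_0: "partial_sum k 0 h = of_bool (h = 0)"
  by (simp add: partial_sum_altdef partial_perms_zero weight_def ends_def)

lemma sum_mult_lin_comb:
  fixes w X Y Z :: "'b \<Rightarrow> 'a::comm_semiring_1"
  shows "(\<Sum>i\<in>A. w i * (a * X i + b * Y i + c * Z i)) =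
    a * (\<Sum>i\<in>A. w i * X i) + b * (\<Sum>i\<in>A. w i * Y i) + c * (\<Sum>i\<in>A. w i * Z i)"
  by (simp add: sum_distrib_left sum.distrib[symmetric] algebra_simps)

lemma partial_sum_Suc:
  "partial_sum k (Suc n) h = (if h \<le> k then
     (if h = 0 then 0 else var_v) * partial_sum k n (h - 1) +
     (of_nat h * (1 + var_v) + var_t * var_u) * partial_sum k n h +
     of_nat (Suc h) * (of_nat h + var_t) * partial_sum k n (Suc h) else 0)"
proof -
  define \<phi> :: "nat \<Rightarrow> coeff_ring" where "\<phi> = (\<lambda>i. of_bool (i = h))"
  define W where "W = (\<lambda>f. weight k (Suc n) f * \<phi> (card (ends (Suc n) f)))"
  define L where "L = (\<lambda>f. local_weight k (Suc n) f * \<phi> (card (ends (Suc n) f)))"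
  have "partial_sum k (Suc n) h = (\<Sum>f\<in>partial_perms (Suc n). W f)"
    by (simp add: partial_sum_altdef W_def \<phi>_def)
  also have "\<dots> = (\<Sum>x\<in>(SIGMA g:partial_perms n. choices n g). W (case x of (g, c) \<Rightarrow> extend n g c))"
    by (rule sum.reindex_bij_betw[OF bij_betw_extend, symmetric])
  also have "\<dots> = (\<Sum>g\<in>partial_perms n. \<Sum>c\<in>choices n g. W (extend n g c))"
    by (subst sum.Sigma) (auto simp: finite_partial_perms choices_def case_prod_unfold)
  also have "\<dots> = (\<Sum>g\<in>partial_perms n. weight k n g * (\<Sum>c\<in>choices n g. L (extend n g c)))"
  proof (intro sum.cong refl)
    fix g assume g: "g \<in> partial_perms n"
    have "W (extend n g c) = weight k n g * L (extend n g c)" if "c \<in> choices n g" for c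
      using that weight_Suc[of "extend n g c" n k] extend_in_partial_perms[OF g, of "fst c" "snd c"]
        truncate_extend[OF g, of "fst c" "snd c"]
      by (simp add: W_def L_def mult.assoc)
    then show "(\<Sum>c\<in>choices n g. W (extend n g c)) = weight k n g * (\<Sum>c\<in>choices n g. L (extend n g c))"
      unfolding sum_distrib_left by (intro sum.cong refl)
  qed
  also have "\<dots> = (\<Sum>g\<in>partial_perms n. weight k n g *
      (if h \<le> k then
        (if h = 0 then 0 else var_v) * of_bool (card (ends n g) = h - 1) +
        (of_nat h * (1 + var_v) + var_t * var_u) * of_bool (card (ends n g) = h) +
        of_nat (Suc h) * (of_nat h + var_t) * of_bool (card (ends n g) = Suc h) else 0))"
    (is "_ = (\<Sum>g\<in>_. _ * ?R g)")
  proof (intro sum.cong refl arg_cong2[where f = "(*)"])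
    fix g assume g: "g \<in> partial_perms n"
    show "(\<Sum>c\<in>choices n g. L (extend n g c)) = ?R g"
      unfolding L_def sum_choices[OF g] by (auto simp: \<phi>_def)
  qed
  also have "\<dots> = (if h \<le> k then
     (if h = 0 then 0 else var_v) * partial_sum k n (h - 1) +
     (of_nat h * (1 + var_v) + var_t * var_u) * partial_sum k n h +
     of_nat (Suc h) * (of_nat h + var_t) * partial_sum k n (Suc h) else 0)"
    by (cases "h \<le> k")
      (simp_all only: partial_sum_altdef sum_mult_lin_comb if_True if_False mult_zero_right
        sum.neutral_const)
  finally show ?thesis .
qed

section \<open>Permutations as partial permutations without open chains\<close>

lemma partial_perms_no_ends:
  "{f\<in>partial_perms n. card (ends n f) = 0} = {p. p permutes {1..n}}"
proof (intro equalityI subsetI)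
  fix f assume "f \<in> {f\<in>partial_perms n. card (ends n f) = 0}"
  then have f: "f \<in> partial_perms n" and pos: "\<And>j. j \<in> {1..n} \<Longrightarrow> f j \<noteq> 0"
    by (auto simp: ends_def)
  have "{j\<in>{1..n}. f j \<noteq> 0} = {1..n}" using pos by auto
  then have inj: "inj_on f {1..n}" using f by (simp add: partial_perms_def)
  have "f ` {1..n} \<subseteq> {1..n}"
    using pos partial_perms_le[OF f] by (simp add: image_subset_iff Suc_le_eq)
  then have "bij_betw f {1..n} {1..n}"
    using inj by (simp add: bij_betw_def endo_inj_surj)
  then show "f \<in> {p. p permutes {1..n}}"
    using partial_perms_outside[OF f] by (auto intro!: bij_imp_permutes)
next
  fix p assume "p \<in> {p. p permutes {1..n}}"
  then have p: "p permutes {1..n}" by simp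
  then have "p j \<in> {1..n}" if "j \<in> {1..n}" for j
    using that by (simp only: permutes_in_image)
  moreover have "inj_on p A" for A
    using permutes_inj_on[OF p] .
  ultimately show "p \<in> {f\<in>partial_perms n. card (ends n f) = 0}"
    using permutes_not_in[OF p] by (fastforce simp: partial_perms_def ends_def)
qed

lemma cyc_eq_card_cycle_max:
  assumes p: "p permutes {1..n}"
  shows "cyc n p = card {m\<in>{1..n}. cycle_max m p}"
proof -
  have perm: "permutation p"
    using p by (auto simp: permutation_permutes)
  note self = permutation_self_in_orbit[OF perm]
  have "bij_betw (orbit p) {m\<in>{1..n}. cycle_max m p} (orbit p ` {1..n})"
    unfolding bij_betw_def
  proof
    show "inj_on (orbit p) {m\<in>{1..n}. cycle_max m p}"
      by (intro inj_onI antisym) (auto simp: cycle_max_def dest: subsetD)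
    show "orbit p ` {m\<in>{1..n}. cycle_max m p} = orbit p ` {1..n}"
    proof (intro equalityI subsetI)
      fix A assume "A \<in> orbit p ` {1..n}"
      then obtain j where j: "j \<in> {1..n}" "A = orbit p j" by auto
      define m where "m = Max A"
      have "finite A" using j finite_orbit[OF self] by simp
      moreover have "A \<noteq> {}" using j self[of j] by auto
      ultimately have m: "m \<in> A" "A \<subseteq> {..m}"
        by (auto simp: m_def)
      have "orbit p m = A"
        using m cyclic_on_orbit'[OF perm] orbit_cyclic_eq3 j by metis
      moreover have "m \<in> {1..n}"
        using m j permutes_orbit_subset[OF p] by blast
      ultimately show "A \<in> orbit p ` {m\<in>{1..n}. cycle_max m p}"
        using m by (intro image_eqI[of _ _ m]) (auto simp: cycle_max_def)
    qed auto
  qed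
  then show ?thesis
    by (simp add: cyc_def bij_betw_same_card)
qed

lemma prod_if_one:
  fixes x :: "'a::comm_monoid_mult"
  assumes "finite A"
  shows "(\<Prod>m\<in>A. if P m then x else 1) = x ^ card {m\<in>A. P m}"
  using assms by (simp add: prod.inter_filter[symmetric])

lemma prod_of_bool:
  assumes "finite A"
  shows "(\<Prod>m\<in>A. if P m then 1 else 0) = (if \<forall>m\<in>A. P m then 1 else 0 :: 'a::comm_semiring_1)"
  using assms by (induction A) auto

definition perm_monomial :: "nat \<Rightarrow> (nat \<Rightarrow> nat) \<Rightarrow> coeff_ring" where
  "perm_monomial n p = var_t ^ cyc n p * var_u ^ fp n p * var_v ^ exc n p"

lemma weight_permutation:
  assumes p: "p permutes {1..n}"
  shows "weight k n p = (if p \<in> bounded_perms k n then perm_monomial n p else 0)"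
proof -
  have nz: "p m \<noteq> 0" if "m \<in> {1..n}" for m
    using permutes_in_image[OF p, of m] that by auto
  have "exc n p = card {m\<in>{1..n}. p m = 0 \<or> p m > m}"
    unfolding exc_def using nz by (intro arg_cong[where f = card]) blast
  moreover have "level m p = card {j\<in>{1..n}. j \<le> m \<and> p j > m}" if "m \<in> {1..n}" for m
    unfolding level_def using that by (intro arg_cong[where f = card]) (use nz in force)
  then have "p \<in> bounded_perms k n \<longleftrightarrow> (\<forall>m\<in>{1..n}. level m p \<le> k)"
    using p by (auto simp: bounded_perms_def)
  ultimately show ?thesis
    unfolding weight_def local_weight_def prod.distrib prod_if_one[OF finite_atLeastAtMost]
      prod_of_bool[OF finite_atLeastAtMost] perm_monomial_def cyc_eq_card_cycle_max[OF p] fp_def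
    by simp
qed

lemma finite_bounded_perms: "finite (bounded_perms k n)"
  by (rule finite_subset[OF _ finite_permutations[of "{1..n}"]]) (auto simp: bounded_perms_def)

lemma of_nat_card_mult:
  fixes x :: "'a::semiring_1"
  assumes "finite A"
  shows "of_nat (card {a\<in>A. P a}) * x = (\<Sum>a\<in>A. if P a then x else 0)"
  using assms by (simp add: sum.inter_filter[symmetric])

lemma F_nth_eq_sum: "fps_nth (F k) n = (\<Sum>p\<in>bounded_perms k n. perm_monomial n p)"
proof -
  have "fps_nth (F k) n = (\<Sum>p\<in>bounded_perms k n. \<Sum>c\<le>n. \<Sum>i\<le>n. \<Sum>j\<le>n.
      if cyc n p = c \<and> fp n p = i \<and> exc n p = j then var_t ^ c * var_u ^ i * var_v ^ j else 0)"
    unfolding F_def fps_nth_Abs_fps of_nat_card_mult[OF finite_bounded_perms]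
      sum.swap[where A = "{..n}" and B = "bounded_perms k n"] ..
  also have "\<dots> = (\<Sum>p\<in>bounded_perms k n. perm_monomial n p)"
  proof (intro sum.cong refl)
    fix p
    have nest: "(if cyc n p = c \<and> fp n p = i \<and> exc n p = j then x else 0) =
        (if exc n p = j then if fp n p = i then if cyc n p = c then x else 0 else 0 else 0)"
      for c i j and x :: coeff_ring
      by simp
    show "(\<Sum>c\<le>n. \<Sum>i\<le>n. \<Sum>j\<le>n.
        if cyc n p = c \<and> fp n p = i \<and> exc n p = j then var_t ^ c * var_u ^ i * var_v ^ j else 0) =
      perm_monomial n p"
      by (simp only: nest sum.delta' finite_atMost atMost_iff cyc_le fp_le exc_le if_True perm_monomial_def)
  qed
  finally show ?thesis .
qed

lemma F_nth: "fps_nth (F k) n = partial_sum k n 0"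
proof -
  have "partial_sum k n 0 = (\<Sum>p | p permutes {1..n}. weight k n p)"
    unfolding partial_sum_def partial_perms_no_ends ..
  also have "\<dots> = (\<Sum>p\<in>bounded_perms k n. perm_monomial n p)"
    by (rule sum.mono_neutral_cong_right)
      (auto simp: weight_permutation finite_permutations bounded_perms_def)
  finally show ?thesis by (simp add: F_nth_eq_sum)
qed

section \<open>The continued fraction\<close>

definition level_series :: "nat \<Rightarrow> nat \<Rightarrow> coeff_ring fps" where
  "level_series k h = Abs_fps (\<lambda>n. partial_sum k n h)"

lemma lin_level_times_level_series:
  assumes "h \<le> k"
  shows "lin_level h * level_series k h =
    (if h = 0 then 1 else fps_const var_v * (fps_X * level_series k (h - 1))) +
    fps_const (of_nat (Suc h) * (of_nat h + var_t)) * (fps_X * level_series k (Suc h))"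
proof (rule fps_ext)
  fix n
  show "fps_nth (lin_level h * level_series k h) n = fps_nth (
    (if h = 0 then 1 else fps_const var_v * (fps_X * level_series k (h - 1))) +
    fps_const (of_nat (Suc h) * (of_nat h + var_t)) * (fps_X * level_series k (Suc h))) n"
  proof (cases n)
    case 0
    then show ?thesis
      by (simp add: lin_level_def level_series_def partial_sum_0)
  next
    case (Suc m)
    define c where "c = of_nat h * (1 + var_v) + var_t * var_u"
    define d where "d = of_nat (Suc h) * (of_nat h + var_t)"
    have "lin_level h * level_series k h = level_series k h - fps_const c * (fps_X * level_series k h)"
      by (simp only: lin_level_def c_def left_diff_distrib mult_1_left mult.assoc)
    then show ?thesis
      using partial_sum_Suc[of k m h] assms Suc
      by (simp add: c_def[symmetric] d_def[symmetric] level_series_def del: of_nat_Suc)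
  qed
qed

lemma partial_sum_above: "k < h \<Longrightarrow> partial_sum k n h = 0"
  by (cases n) (simp_all add: partial_sum_0 partial_sum_Suc)

lemma eq_mult_of_mult_eq:
  fixes a b x y :: "'a::comm_monoid_mult"
  assumes "a * b = 1" "a * x = y"
  shows "x = b * y"
  using assms by (metis mult.assoc mult.commute mult_1_left)

lemma cf_denom_times_level_series:
  assumes "h \<le> k"
  shows "cf_denom k h * level_series k h =
    (if h = 0 then 1 else fps_const var_v * (fps_X * level_series k (h - 1)))"
  using assms
proof (induction h rule: inc_induct)
  case base
  have "level_series k (Suc k) = 0"
    by (simp add: level_series_def partial_sum_above fps_eq_iff)
  then show ?case
    using lin_level_times_level_series[of k k] by (subst cf_denom.simps) simp
next
  case (step h)
  define R where "R = fps_recip (cf_denom k (Suc h))"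
  define c where "c = fps_const (of_nat (Suc h) * (of_nat h + var_t))"
  define v where "v = fps_const var_v"
  have "cf_denom k (Suc h) * level_series k (Suc h) = v * (fps_X * level_series k h)"
    using step.IH by (simp add: v_def)
  then have next_level: "level_series k (Suc h) = R * (v * (fps_X * level_series k h))"
    unfolding R_def by (rule eq_mult_of_mult_eq[OF cf_denom_recip])
  have "cf_denom k h = lin_level h - c * v * fps_X ^ 2 * R"
    using step.hyps by (subst cf_denom.simps) (simp add: c_def v_def R_def)
  then have "cf_denom k h * level_series k h =
      lin_level h * level_series k h - c * (fps_X * level_series k (Suc h))"
    unfolding next_level by (simp only: left_diff_distrib right_diff_distrib power2_eq_square mult_ac)
  then show ?case
    using lin_level_times_level_series[of h k] step.hyps by (simp add: c_def)
qed

theorem theorem6p1: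
  fixes k :: nat
  shows "F k = fps_recip (cf_denom k 0)"
proof -
  have "F k = level_series k 0"
    by (simp add: fps_eq_iff F_nth level_series_def)
  then have "cf_denom k 0 * F k = 1"
    using cf_denom_times_level_series[of 0 k] by simp
  then show ?thesis
    using eq_mult_of_mult_eq[OF cf_denom_recip, of k 0 "F k" 1] by simp
qed

end
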